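(* Let $S$ be a meager semifilter, and let $X\subseteq[\mathbb N]^\infty$ be an $S$-scale. Then, in the realm of hereditarily Lindelöf spaces, the real set $X\cup[\mathbb N]^{<\infty}$ is productively Hurewicz; that is, for each hereditarily Lindelöf Hurewicz space $Y$, the product space $(X\cup[\mathbb N]^{<\infty})\times Y$ is Hurewicz.
   Context: $\mathbb N=\{1,2,\dots\}$. The family $P(\mathbb N)$ of all subsets of $\mathbb N$ is identified with the Cantor space $\{0,1\}^{\mathbb N}$, with its topology; $[\mathbb N]^{\infty}$ and $[\mathbb N]^{<\infty}$ are the subspaces of infinite and of finite subsets of $\mathbb N$, respectively. Each $a\in[\mathbb N]^\infty$ is identified with its increasing enumeration: $a(n)$ is the $n$-th element of $a$. For sets $a,b$, $a\subseteq^* b$ means $a\setminus b$ is finite. A semifilter is a nonempty set $S\subseteq[\mathbb N]^\infty$ such that $s\in S$, $b\in[\mathbb N]^\infty$ and $s\subseteq^* b$ imply $b\in S$. It is meager if it is meager as a subset of the space $P(\mathbb N)$. Let $S^+=\{a\in[\mathbb N]^\infty:\mathbb N\setminus a\notin S\}$. For $a,b\in[\mathbb N]^\infty$ let $[a\le b]=\{n: a(n)\le b(n)\}$, and for $R\subseteq[\mathbb N]^\infty$ write $a\le_R b$ if $[a\le b]\in R$. $\mathfrak b(S)$ is the minimal cardinality of a subset of $[\mathbb N]^\infty$ with no $\le_S$-upper bound in $[\mathbb N]^\infty$. A set $X\subseteq[\mathbb N]^\infty$ with $|X|\ge\mathfrak b(S)$ is an $S$-scale if for each $b\in[\mathbb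 N]^\infty$ there is $c\in[\mathbb N]^\infty$ such that $b\le_{S^+}c\le_S x$ for all but less than $\mathfrak b(S)$ elements $x\in X$. A topological space $X$ is Hurewicz if for each sequence $\mathcal U_1,\mathcal U_2,\dots$ of open covers of $X$ there are finite sets $\mathcal F_1\subseteq\mathcal U_1,\mathcal F_2\subseteq\mathcal U_2,\dots$ such that for all points $x\in X$ the set $\{n: x\in\bigcup\mathcal F_n\}$ is cofinite in $\mathbb N$. *)

theory Defs
  imports "HOL-Analysis.Analysis"
begin

unbundle cardinal_syntax

abbreviation posnat :: "nat set" ("\<nat>\<^sub>1")
  where "\<nat>\<^sub>1 \<equiv> {1..}"

text \<open>
  The identification of a subset of \<open>\<nat>\<^sub>1\<close> with its characteristic function, an (extensional)
  element of the product of copies of the discrete two-point space indexed by \<open>\<nat>\<^sub>1\<close>.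
\<close>

definition Cantor :: "nat set topology" where
  "Cantor = pullback_topology (Pow \<nat>\<^sub>1) (\<lambda>a. \<lambda>n\<in>\<nat>\<^sub>1. n \<in> a)
              (product_topology (\<lambda>_. discrete_topology (UNIV :: bool set)) \<nat>\<^sub>1)"

lemma topspace_Cantor: "topspace Cantor = Pow \<nat>\<^sub>1"
  by (auto simp: Cantor_def topspace_pullback_topology)

definition Inf_sets :: "nat set set" where
  "Inf_sets = {a. a \<subseteq> \<nat>\<^sub>1 \<and> infinite a}"

definition Fin_sets :: "nat set set" where
  "Fin_sets = {a. a \<subseteq> \<nat>\<^sub>1 \<and> finite a}"

definition nowhere_dense_in :: "'a topology \<Rightarrow> 'a set \<Rightarrow> bool" where
  "nowhere_dense_in T A \<longleftrightarrow> A \<subseteq> topspace T \<and> T interior_of (T closure_of A) = {}"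

definition meager_in :: "'a topology \<Rightarrow> 'a set \<Rightarrow> bool" where
  "meager_in T A \<longleftrightarrow> (\<exists>\<N>. countable \<N> \<and> (\<forall>N\<in>\<N>. nowhere_dense_in T N) \<and> A = \<Union>\<N>)"

definition almost_subset :: "nat set \<Rightarrow> nat set \<Rightarrow> bool" (infix "\<subseteq>*" 50) where
  "a \<subseteq>* b \<longleftrightarrow> finite (a - b)"

definition semifilter :: "nat set set \<Rightarrow> bool" where
  "semifilter S \<longleftrightarrow> S \<noteq> {} \<and> S \<subseteq> Inf_sets \<and>
     (\<forall>s\<in>S. \<forall>b\<in>Inf_sets. s \<subseteq>* b \<longrightarrow> b \<in> S)"

definition splus :: "nat set set \<Rightarrow> nat set set" where
  "splus S = {a \<in> Inf_sets. \<nat>\<^sub>1 - a \<notin> S}"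

text \<open>The library's \<^const>\<open>enumerate\<close> counts from 0, whereas here the least element of
  \<open>a\<close> is its first element.\<close>

definition nth_elem :: "nat set \<Rightarrow> nat \<Rightarrow> nat" where
  "nth_elem a n = enumerate a (n - 1)"

definition le_set :: "nat set \<Rightarrow> nat set \<Rightarrow> nat set" where
  "le_set a b = {n \<in> \<nat>\<^sub>1. nth_elem a n \<le> nth_elem b n}"

definition le_rel :: "nat set set \<Rightarrow> nat set \<Rightarrow> nat set \<Rightarrow> bool" where
  "le_rel R a b \<longleftrightarrow> le_set a b \<in> R"

definition unbounded_rel :: "nat set set \<Rightarrow> nat set set \<Rightarrow> bool" where
  "unbounded_rel S B \<longleftrightarrow> B \<subseteq> Inf_sets \<and> \<not> (\<exists>c\<in>Inf_sets. \<forall>b\<in>B. le_rel S b c)"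

text \<open>A cardinal is represented by a cardinal order, which is unique up to order isomorphism;
  the lemma \<open>bnum\<close> below shows that the minimum exists when \<open>S\<close> is a semifilter.\<close>

definition bnum :: "nat set set \<Rightarrow> nat set rel" where
  "bnum S = (SOME r. (\<exists>B. unbounded_rel S B \<and> r = |B| ) \<and>
                     (\<forall>C. unbounded_rel S C \<longrightarrow> r \<le>o |C| ))"

lemma unbounded_Inf_sets:
  assumes "semifilter S"
  shows "unbounded_rel S Inf_sets"
proof -
  have "\<exists>b\<in>Inf_sets. \<not> le_rel S b c" if c: "c \<in> Inf_sets" for c
  proof
    define b where "b = Suc ` c"
    have inf: "infinite c" using c by (simp add: Inf_sets_def)
    have b_inf: "infinite b" unfolding b_def using inf by (simp add: finite_image_iff)
    show "b \<in> Inf_sets" using b_inf by (auto simp: b_def Inf_sets_def)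
    have gt: "enumerate c n < enumerate b n" for n
    proof -
      have "enumerate b n = Suc (enumerate c n)"
      proof (induction n rule: less_induct)
        case (less n)
        show ?case
        proof (cases n)
          case 0
          have "(LEAST x. x \<in> Suc ` c) = Suc (LEAST x. x \<in> c)"
          proof (rule Least_equality)
            show "Suc (LEAST x. x \<in> c) \<in> Suc ` c"
              using inf by (metis LeastI_ex all_not_in_conv finite.emptyI imageI)
          qed (auto intro: Least_le)
          then show ?thesis using 0 by (simp add: b_def enumerate_0)
        next
          case (Suc m)
          have IH: "enumerate b m = Suc (enumerate c m)" using less Suc by simp
          have ex: "\<exists>x. x \<in> c \<and> enumerate c m < x"
            using inf by (meson infinite_nat_iff_unbounded)
          have "(LEAST x. x \<in> b \<and> enumerate b m < x) = Suc (LEAST x. x \<in> c \<and> enumerate c m < x)"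
          proof (rule Least_equality)
            show "Suc (LEAST x. x \<in> c \<and> enumerate c m < x) \<in> b \<and>
                  enumerate b m < Suc (LEAST x. x \<in> c \<and> enumerate c m < x)"
              using LeastI_ex[OF ex] unfolding IH by (simp add: b_def)
          next
            fix y assume "y \<in> b \<and> enumerate b m < y"
            then show "Suc (LEAST x. x \<in> c \<and> enumerate c m < x) \<le> y"
              unfolding IH by (auto simp: b_def intro: Least_le)
          qed
          then show ?thesis using Suc by (simp add: enumerate_Suc'' b_inf inf)
        qed
      qed
      then show ?thesis by simp
    qed
    have "le_set b c = {}"
      using gt by (auto simp: le_set_def nth_elem_def not_le)
    then show "\<not> le_rel S b c"
      using assms by (auto simp: le_rel_def semifilter_def Inf_sets_def)
  qed
  then show ?thesis by (auto simp: unbounded_rel_def)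
qed

lemma bnum:
  assumes "semifilter S"
  shows "(\<exists>B. unbounded_rel S B \<and> bnum S = |B| ) \<and> (\<forall>C. unbounded_rel S C \<longrightarrow> bnum S \<le>o |C| )"
proof -
  let ?R = "{|B| | B. unbounded_rel S B}"
  have "\<exists>r\<in>?R. \<forall>r'\<in>?R. r \<le>o r'"
    using unbounded_Inf_sets[OF assms] by (intro exists_minim_Card_order) (auto simp: card_of_Card_order)
  then have "\<exists>r. (\<exists>B. unbounded_rel S B \<and> r = |B| ) \<and> (\<forall>C. unbounded_rel S C \<longrightarrow> r \<le>o |C| )"
    by blast
  then show ?thesis
    unfolding bnum_def by (rule someI_ex)
qed

definition semifilter_scale :: "nat set set \<Rightarrow> nat set set \<Rightarrow> bool" where
  "semifilter_scale S X \<longleftrightarrow> X \<subseteq> Inf_sets \<and> bnum S \<le>o |X| \<and>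
     (\<forall>b\<in>Inf_sets. \<exists>c\<in>Inf_sets.
        |{x \<in> X. \<not> (le_rel (splus S) b c \<and> le_rel S c x)}| <o bnum S)"

definition open_cover :: "'a topology \<Rightarrow> 'a set set \<Rightarrow> bool" where
  "open_cover X \<U> \<longleftrightarrow> (\<forall>V\<in>\<U>. openin X V) \<and> \<Union>\<U> = topspace X"

definition Hurewicz_space :: "'a topology \<Rightarrow> bool" where
  "Hurewicz_space X \<longleftrightarrow>
     (\<forall>\<U> :: nat \<Rightarrow> 'a set set. (\<forall>n\<in>\<nat>\<^sub>1. open_cover X (\<U> n)) \<longrightarrow>
        (\<exists>\<F>. (\<forall>n\<in>\<nat>\<^sub>1. finite (\<F> n) \<and> \<F> n \<subseteq> \<U> n) \<and>
             (\<forall>x\<in>topspace X. finite (\<nat>\<^sub>1 - {n \<in> \<nat>\<^sub>1. x \<in> \<Union>(\<F> n)}))))"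

end

theory Submission
  imports Defs
begin

text \<open>
  A meager semifilter \<open>S\<close> admits (Talagrand) an increasing \<open>h\<close> such that every \<open>s \<in> S\<close> meets almost
  all intervals \<open>[h i, h (i + 1))\<close>; so an \<open>S\<close>-bound becomes an eventual bound after passing to \<open>h\<close>.
  Consequently fewer than \<open>\<bb>(S)\<close> points \<open>x \<in> X\<close> can be handled one slice \<open>{x} \<times> Y\<close> at a time, because
  the covers may be taken countable: the product is Lindelof, \<open>Y\<close> being hereditarily so.

  For the other points, the Hurewicz property of \<open>Y\<close> yields a fast sequence \<open>b\<close> such that, for each
  \<open>y\<close>, almost all \<open>j\<close> and all \<open>n \<le> j\<close>, finitely many members of the \<open>n\<close>-th cover contain \<open>(x, y)\<close>
  whenever \<open>x\<close> misses \<open>[b j, b (j + 1))\<close>. Applying the scale property to a set growing much faster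
  than \<open>b \<circ> h\<close> gives \<open>c\<close> with \<open>b (i + h (i + 1)) \<le> c (h i)\<close> for infinitely many \<open>i\<close>. If
  \<open>c \<le>\<^sub>S x\<close>, then for such large \<open>i \<ge> n\<close> some \<open>p \<in> [h i, h (i + 1))\<close> has \<open>b (n + h (i + 1)) \<le> x p\<close>, so
  \<open>x\<close> has fewer than \<open>h (i + 1)\<close> elements below \<open>b (n + h (i + 1))\<close> and misses one of the \<open>h (i + 1)\<close>
  intervals \<open>[b j, b (j + 1))\<close> with \<open>n \<le> j < n + h (i + 1)\<close>.
\<close>

lemma openin_Cantor_cylinder: "openin Cantor {z. z \<subseteq> \<nat>\<^sub>1 \<and> z \<inter> {..<m} = s}"
proof (cases "s \<subseteq> \<nat>\<^sub>1 \<inter> {..<m}")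
  case True
  define U where "U = (\<lambda>n. if n < m then {n \<in> s} else UNIV)"
  have "openin (product_topology (\<lambda>_. discrete_topology (UNIV :: bool set)) \<nat>\<^sub>1) (Pi\<^sub>E \<nat>\<^sub>1 U)"
    by (rule product_topology_basis) (auto simp: U_def intro: finite_subset[of _ "{..<m}"])
  moreover have "{z. z \<subseteq> \<nat>\<^sub>1 \<and> z \<inter> {..<m} = s} = (\<lambda>a. \<lambda>n\<in>\<nat>\<^sub>1. n \<in> a) -` Pi\<^sub>E \<nat>\<^sub>1 U \<inter> Pow \<nat>\<^sub>1"
  proof -
    have "(\<lambda>n\<in>\<nat>\<^sub>1. n \<in> z) \<in> Pi\<^sub>E \<nat>\<^sub>1 U \<longleftrightarrow> z \<inter> {..<m} = s" if "z \<subseteq> \<nat>\<^sub>1" for z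
    proof -
      have "(\<lambda>n\<in>\<nat>\<^sub>1. n \<in> z) \<in> Pi\<^sub>E \<nat>\<^sub>1 U \<longleftrightarrow> (\<forall>n\<in>\<nat>\<^sub>1. n < m \<longrightarrow> (n \<in> z) = (n \<in> s))"
        by (simp add: U_def PiE_iff)
      also have "\<dots> \<longleftrightarrow> z \<inter> {..<m} = s" using that True by blast
      finally show ?thesis .
    qed
    then show ?thesis by (intro set_eqI) (simp only: mem_Collect_eq Int_iff vimage_eq Pow_iff conj_commute cong: conj_cong)
  qed
  ultimately show ?thesis
    unfolding Cantor_def openin_pullback_topology by blast
next
  case False
  then have "{z. z \<subseteq> \<nat>\<^sub>1 \<and> z \<inter> {..<m} = s} = {}" by auto
  then show ?thesis by (metis openin_empty)
qed

lemma openin_Cantor_contains_cylinder: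
  assumes "openin Cantor U" "x \<in> U"
  obtains m where "\<And>z. \<lbrakk>z \<subseteq> \<nat>\<^sub>1; z \<inter> {..<m} = x \<inter> {..<m}\<rbrakk> \<Longrightarrow> z \<in> U"
proof -
  let ?f = "\<lambda>a::nat set. \<lambda>n\<in>\<nat>\<^sub>1. n \<in> a"
  obtain W where W: "openin (product_topology (\<lambda>_. discrete_topology (UNIV :: bool set)) \<nat>\<^sub>1) W"
    and U: "U = ?f -` W \<inter> Pow \<nat>\<^sub>1"
    using assms(1) unfolding Cantor_def openin_pullback_topology by blast
  have "?f x \<in> W" using assms(2) U by blast
  then obtain V where V: "?f x \<in> Pi\<^sub>E \<nat>\<^sub>1 V" "Pi\<^sub>E \<nat>\<^sub>1 V \<subseteq> W" "finite {i. V i \<noteq> UNIV}"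
    using product_topology_open_contains_basis[OF W] by (metis topspace_discrete_topology)
  obtain m where "\<forall>i\<in>{i. V i \<noteq> UNIV}. i < m"
    using V(3)[unfolded finite_nat_set_iff_bounded] ..
  then have m: "i < m" if "V i \<noteq> UNIV" for i using that by simp
  have "z \<in> U" if z: "z \<subseteq> \<nat>\<^sub>1" "z \<inter> {..<m} = x \<inter> {..<m}" for z
  proof -
    have "?f z \<in> Pi\<^sub>E \<nat>\<^sub>1 V"
    proof (rule PiE_I)
      fix i assume i: "i \<in> \<nat>\<^sub>1"
      show "?f z i \<in> V i"
      proof (cases "V i = UNIV")
        case False
        then have "(i \<in> z) = (i \<in> x)" using m z(2) by blast
        then show ?thesis using V(1) i by (auto simp: PiE_iff)
      qed simp
    qed auto
    then show ?thesis using V(2) U z(1) by blast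
  qed
  then show thesis by (rule that)
qed

lemma second_countable_Cantor: "second_countable Cantor"
  unfolding second_countable_def
proof (intro exI conjI ballI allI impI)
  let ?B = "(\<lambda>(m, s). {z. z \<subseteq> \<nat>\<^sub>1 \<and> z \<inter> {..<m} = s}) ` (SIGMA m:UNIV. Pow {..<m::nat})"
  show "countable ?B" by (intro countable_image countable_SIGMA) (auto intro: countable_finite)
  show "openin Cantor V" if "V \<in> ?B" for V
    using that openin_Cantor_cylinder by auto
  fix U x assume "openin Cantor U \<and> x \<in> U"
  then have U: "openin Cantor U" "x \<in> U" by auto
  obtain m where m: "\<And>z. \<lbrakk>z \<subseteq> \<nat>\<^sub>1; z \<inter> {..<m} = x \<inter> {..<m}\<rbrakk> \<Longrightarrow> z \<in> U"
    using openin_Cantor_contains_cylinder[OF U] by blast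
  have "x \<subseteq> \<nat>\<^sub>1" using U openin_subset topspace_Cantor by blast
  then show "\<exists>V\<in>?B. x \<in> V \<and> V \<subseteq> U"
    using m by (intro bexI[of _ "{z. z \<subseteq> \<nat>\<^sub>1 \<and> z \<inter> {..<m} = x \<inter> {..<m}}"] image_eqI[of _ _ "(m, x \<inter> {..<m})"]) auto
qed

lemma Lindelof_space_prod_second_countable:
  assumes X: "second_countable X" and Y: "hereditarily Lindelof_space Y"
  shows "Lindelof_space (prod_topology X Y)"
  unfolding Lindelof_space_def
proof (intro allI impI)
  fix \<U> assume \<U>: "(\<forall>U\<in>\<U>. openin (prod_topology X Y) U) \<and> \<Union>\<U> = topspace (prod_topology X Y)"
  obtain \<B> where \<B>: "countable \<B>" "\<And>B. B \<in> \<B> \<Longrightarrow> openin X B"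
    "\<And>U x. \<lbrakk>openin X U; x \<in> U\<rbrakk> \<Longrightarrow> \<exists>B\<in>\<B>. x \<in> B \<and> B \<subseteq> U"
    using X unfolding second_countable_def by metis
  define \<V> where "\<V> B = {V. openin Y V \<and> (\<exists>U\<in>\<U>. B \<times> V \<subseteq> U)}" for B
  have "\<exists>\<C>. countable \<C> \<and> \<C> \<subseteq> \<V> B \<and> \<Union>(\<V> B) \<subseteq> \<Union>\<C>" for B
  proof -
    have "Lindelof_space (subtopology Y (\<Union>(\<V> B)))"
      using Y by (simp add: hereditarily)
    moreover have "\<Union>(\<V> B) \<subseteq> topspace Y" "\<forall>V\<in>\<V> B. openin Y V"
      by (auto simp: \<V>_def dest: openin_subset)
    ultimately show ?thesis
      by (simp add: Lindelof_space_subtopology_subset)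
  qed
  then obtain \<C> where \<C>: "\<And>B. countable (\<C> B)" "\<And>B. \<C> B \<subseteq> \<V> B" "\<And>B. \<Union>(\<V> B) \<subseteq> \<Union>(\<C> B)"
    by metis
  have "\<exists>U\<in>\<U>. B \<times> V \<subseteq> U" if "V \<in> \<C> B" for B V
    using that \<C>(2)[of B] unfolding \<V>_def by blast
  then have "\<forall>B V. \<exists>U. V \<in> \<C> B \<longrightarrow> U \<in> \<U> \<and> B \<times> V \<subseteq> U" by blast
  then obtain u where u: "\<And>B V. V \<in> \<C> B \<Longrightarrow> u B V \<in> \<U> \<and> B \<times> V \<subseteq> u B V"
    by metis
  let ?W = "(\<lambda>(B, V). u B V) ` (SIGMA B:\<B>. \<C> B)"
  have "countable ?W" using \<B>(1) \<C>(1) by auto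
  moreover have W: "?W \<subseteq> \<U>" using u by auto
  moreover have "\<Union>?W = topspace (prod_topology X Y)"
  proof
    show "\<Union>?W \<subseteq> topspace (prod_topology X Y)" using W \<U> by blast
    show "topspace (prod_topology X Y) \<subseteq> \<Union>?W"
    proof (clarify)
      fix x y assume "(x, y) \<in> topspace (prod_topology X Y)"
      then obtain U where U: "U \<in> \<U>" "(x, y) \<in> U" using \<U> by blast
      then obtain G V where G: "openin X G" "openin Y V" "x \<in> G" "y \<in> V" "G \<times> V \<subseteq> U"
        using \<U> U unfolding openin_prod_topology_alt by meson
      then obtain B where B: "B \<in> \<B>" "x \<in> B" "B \<subseteq> G" using \<B>(3) by blast
      have "V \<in> \<V> B" using G B U by (auto simp: \<V>_def)
      then obtain V' where "V' \<in> \<C> B" "y \<in> V'" using \<C>(3) G(4) by blast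
      with u B show "(x, y) \<in> \<Union>?W" by blast
    qed
  qed
  ultimately show "\<exists>\<V>. countable \<V> \<and> \<V> \<subseteq> \<U> \<and> \<Union>\<V> = topspace (prod_topology X Y)"
    by blast
qed

lemma Hurewicz_space_countable_index:
  fixes \<U> :: "'i::countable \<Rightarrow> 'a set set"
  assumes "Hurewicz_space Y" and \<U>: "\<And>i. open_cover Y (\<U> i)"
  shows "\<exists>\<F>. (\<forall>i. finite (\<F> i) \<and> \<F> i \<subseteq> \<U> i) \<and> (\<forall>y\<in>topspace Y. finite {i. y \<notin> \<Union>(\<F> i)})"
proof -
  have "\<forall>n\<in>\<nat>\<^sub>1. open_cover Y (\<U> (from_nat (n - 1)))" using \<U> by blast
  then have "\<exists>\<F>. (\<forall>n\<in>\<nat>\<^sub>1. finite (\<F> n) \<and> \<F> n \<subseteq> \<U> (from_nat (n - 1))) \<and>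
      (\<forall>y\<in>topspace Y. finite (\<nat>\<^sub>1 - {n \<in> \<nat>\<^sub>1. y \<in> \<Union>(\<F> n)}))"
    by (rule assms(1)[unfolded Hurewicz_space_def, THEN spec, THEN mp])
  then obtain \<F> where \<F>: "\<forall>n\<in>\<nat>\<^sub>1. finite (\<F> n) \<and> \<F> n \<subseteq> \<U> (from_nat (n - 1))"
    "\<forall>y\<in>topspace Y. finite (\<nat>\<^sub>1 - {n \<in> \<nat>\<^sub>1. y \<in> \<Union>(\<F> n)})"
    by blast
  let ?c = "\<lambda>i::'i. Suc (to_nat i)"
  have "finite {i. y \<notin> \<Union>(\<F> (?c i))}" if "y \<in> topspace Y" for y
  proof -
    have "inj ?c" by (simp add: inj_def)
    moreover have "finite (\<nat>\<^sub>1 - {n \<in> \<nat>\<^sub>1. y \<in> \<Union>(\<F> n)})" using \<F>(2) that by blast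
    ultimately have "finite (?c -` (\<nat>\<^sub>1 - {n \<in> \<nat>\<^sub>1. y \<in> \<Union>(\<F> n)}))"
      by (rule finite_vimageI[rotated])
    then show ?thesis by (rule rev_finite_subset) auto
  qed
  moreover have "finite (\<F> (?c i))" "\<F> (?c i) \<subseteq> \<U> i" for i using \<F>(1)[rule_format, of "?c i"] by auto
  ultimately show ?thesis by (intro exI[of _ "\<lambda>i. \<F> (?c i)"]) simp
qed

lemma nowhere_dense_in_Cantor_avoid:
  assumes "finite P" and "\<And>s N. (s, N) \<in> P \<Longrightarrow> s \<subseteq> \<nat>\<^sub>1 \<inter> {..<m} \<and> nowhere_dense_in Cantor N"
  shows "\<exists>m' t. m \<le> m' \<and> t \<subseteq> \<nat>\<^sub>1 \<inter> {m..<m'} \<and>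
    (\<forall>s N z. (s, N) \<in> P \<longrightarrow> z \<in> N \<longrightarrow> z \<inter> {..<m'} \<noteq> s \<union> t)"
  using assms
proof (induction P rule: finite_induct)
  case empty
  then show ?case by auto
next
  case (insert p P)
  obtain m1 t1 where 1: "m \<le> m1" "t1 \<subseteq> \<nat>\<^sub>1 \<inter> {m..<m1}"
    "\<And>s N z. \<lbrakk>(s, N) \<in> P; z \<in> N\<rbrakk> \<Longrightarrow> z \<inter> {..<m1} \<noteq> s \<union> t1"
  proof -
    have "\<exists>m' t. m \<le> m' \<and> t \<subseteq> \<nat>\<^sub>1 \<inter> {m..<m'} \<and>
        (\<forall>s N z. (s, N) \<in> P \<longrightarrow> z \<in> N \<longrightarrow> z \<inter> {..<m'} \<noteq> s \<union> t)"
      by (rule insert.IH) (rule insert.prems, rule insertI2)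
    then show thesis using that by (elim exE conjE) simp
  qed
  obtain s N where p: "p = (s, N)" by (cases p)
  then have s: "s \<subseteq> \<nat>\<^sub>1 \<inter> {..<m}" and N: "nowhere_dense_in Cantor N" using insert.prems by auto
  let ?U = "{z. z \<subseteq> \<nat>\<^sub>1 \<and> z \<inter> {..<m1} = s \<union> t1}"
  have "s \<union> t1 \<in> ?U" using s 1 by auto
  moreover have "?U \<subseteq> Cantor interior_of (Cantor closure_of N)" if "?U \<subseteq> Cantor closure_of N"
    by (rule interior_of_maximal[OF that openin_Cantor_cylinder])
  ultimately obtain w where w: "w \<in> ?U" "w \<notin> Cantor closure_of N"
    using N unfolding nowhere_dense_in_def by blast
  then have "w \<in> topspace Cantor" by (simp add: topspace_Cantor)
  with w(2) obtain T where T: "openin Cantor T" "w \<in> T" "T \<inter> N = {}"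
    by (auto simp: in_closure_of)
  obtain k where k: "\<And>z. \<lbrakk>z \<subseteq> \<nat>\<^sub>1; z \<inter> {..<k} = w \<inter> {..<k}\<rbrakk> \<Longrightarrow> z \<in> T"
    using openin_Cantor_contains_cylinder[OF T(1,2)] by blast
  define m' where "m' = max k m1"
  define t where "t = w \<inter> {m..<m'}"
  have "w \<inter> {..<m} = (s \<union> t1) \<inter> {..<m}" using w(1) 1(1) by auto
  also have "\<dots> = s" using s 1(2) by fastforce
  finally have wt: "w \<inter> {..<m'} = s \<union> t"
    using 1(1) unfolding t_def m'_def by fastforce
  have "t1 \<subseteq> w" using w(1) by blast
  moreover have "t \<inter> {..<m1} \<subseteq> t1"
    using w(1) s unfolding t_def by fastforce
  ultimately have t1: "t \<inter> {..<m1} = t1"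
    using 1(2) unfolding t_def m'_def by fastforce
  have "z \<inter> {..<m'} \<noteq> s' \<union> t" if "(s', N') \<in> insert p P" "z \<in> N'" for s' N' z
  proof
    assume z: "z \<inter> {..<m'} = s' \<union> t"
    show False
    proof (cases "(s', N') = p")
      case True
      then have "z \<inter> {..<k} = w \<inter> {..<k}"
        using z wt p unfolding m'_def by fastforce
      moreover have "z \<subseteq> \<nat>\<^sub>1"
        using True p that N by (auto simp: nowhere_dense_in_def topspace_Cantor)
      ultimately show False using k T(3) True p that by blast
    next
      case False
      then have P: "(s', N') \<in> P" using that by blast
      then have "s' \<subseteq> {..<m1}" using insert.prems[of s' N'] 1(1) by auto
      then have "z \<inter> {..<m1} = s' \<union> t1"
        using z t1 unfolding m'_def by fastforce
      then show False using 1(3) P that by blast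
    qed
  qed
  moreover have "m \<le> m'" "t \<subseteq> \<nat>\<^sub>1 \<inter> {m..<m'}"
    using 1(1) w(1) by (auto simp: m'_def t_def)
  ultimately show ?case by blast
qed

text \<open>Between \<open>h i\<close> and \<open>h (i + 1)\<close> place a pattern that forces a set out of the first \<open>i\<close> nowhere
  dense pieces of \<open>S\<close>. Adding these patterns to an \<open>s \<in> S\<close> on infinitely many intervals that it
  misses would keep it in \<open>S\<close> but push it out of every piece.\<close>

lemma meager_semifilter_meets_intervals:
  assumes S: "semifilter S" and "meager_in Cantor S"
  obtains h :: "nat \<Rightarrow> nat" where "strict_mono h"
    "\<And>s. s \<in> S \<Longrightarrow> finite {i. s \<inter> {h i..<h (Suc i)} = {}}"
proof -
  obtain \<N> where \<N>: "countable \<N>" "\<forall>N\<in>\<N>. nowhere_dense_in Cantor N" "S = \<Union>\<N>"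
    using assms(2) unfolding meager_in_def by blast
  have "\<N> \<noteq> {}" using S \<N>(3) by (auto simp: semifilter_def)
  then have en: "range (from_nat_into \<N>) = \<N>" using \<N>(1) by simp
  let ?e = "from_nat_into \<N>"
  define good where "good i m m' t \<longleftrightarrow> m < m' \<and> t \<subseteq> \<nat>\<^sub>1 \<inter> {m..<m'} \<and>
    (\<forall>s k z. s \<subseteq> \<nat>\<^sub>1 \<inter> {..<m} \<longrightarrow> k \<le> i \<longrightarrow> z \<in> ?e k \<longrightarrow> z \<inter> {..<m'} \<noteq> s \<union> t)" for i m m' t
  have "\<exists>m' t. good i m m' t" for i m
  proof -
    let ?P = "Pow (\<nat>\<^sub>1 \<inter> {..<Suc m}) \<times> ?e ` {..i}"
    have "\<exists>m' t. Suc m \<le> m' \<and> t \<subseteq> \<nat>\<^sub>1 \<inter> {Suc m..<m'} \<and>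
        (\<forall>s N z. (s, N) \<in> ?P \<longrightarrow> z \<in> N \<longrightarrow> z \<inter> {..<m'} \<noteq> s \<union> t)"
    proof (rule nowhere_dense_in_Cantor_avoid)
      show "finite ?P" by auto
      show "s \<subseteq> \<nat>\<^sub>1 \<inter> {..<Suc m} \<and> nowhere_dense_in Cantor N" if "(s, N) \<in> ?P" for s N
        using that en \<N>(2) by auto
    qed
    then obtain m' t where t: "Suc m \<le> m'" "t \<subseteq> \<nat>\<^sub>1 \<inter> {Suc m..<m'}"
      "\<forall>s N z. (s, N) \<in> ?P \<longrightarrow> z \<in> N \<longrightarrow> z \<inter> {..<m'} \<noteq> s \<union> t" by (elim exE conjE)
    have "z \<inter> {..<m'} \<noteq> s \<union> t" if "s \<subseteq> \<nat>\<^sub>1 \<inter> {..<m}" "k \<le> i" "z \<in> ?e k" for s k z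
    proof -
      have "(s, ?e k) \<in> ?P" using that by auto
      then show ?thesis using t(3) that(3) by blast
    qed
    moreover have "m < m'" "t \<subseteq> \<nat>\<^sub>1 \<inter> {m..<m'}" using t by auto
    ultimately show ?thesis unfolding good_def by blast
  qed
  then obtain f g where "\<And>i m. good i m (f i m) (g i m)" by metis
  then have fg: "\<And>i m. m < f i m" "\<And>i m. g i m \<subseteq> \<nat>\<^sub>1 \<inter> {m..<f i m}"
    "\<And>i m s k z. \<lbrakk>s \<subseteq> \<nat>\<^sub>1 \<inter> {..<m}; k \<le> i; z \<in> ?e k\<rbrakk> \<Longrightarrow> z \<inter> {..<f i m} \<noteq> s \<union> g i m"
    unfolding good_def by blast+
  define h where "h = rec_nat 0 f"
  have hSuc: "h (Suc i) = f i (h i)" for i by (simp add: h_def)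
  have h: "strict_mono h" by (simp add: strict_mono_Suc_iff hSuc fg(1))
  have "finite {i. s \<inter> {h i..<h (Suc i)} = {}}" if s: "s \<in> S" for s
  proof (rule ccontr)
    define A where "A = {i. s \<inter> {h i..<h (Suc i)} = {}}"
    assume "infinite {i. s \<inter> {h i..<h (Suc i)} = {}}"
    then have A: "infinite A" by (simp add: A_def)
    define s' where "s' = s \<union> (\<Union>i\<in>A. g i (h i))"
    have sI: "s \<subseteq> \<nat>\<^sub>1" "infinite s" using S s by (auto simp: semifilter_def Inf_sets_def)
    have "s' \<subseteq> \<nat>\<^sub>1" using sI fg(2) unfolding s'_def by blast
    moreover have "infinite s'" using sI unfolding s'_def by simp
    ultimately have "s' \<in> Inf_sets" by (simp add: Inf_sets_def)
    moreover have "s \<subseteq>* s'" by (simp add: almost_subset_def s'_def Diff_Un)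
    ultimately have "s' \<in> S" using S s by (simp add: semifilter_def)
    then obtain k where k: "s' \<in> ?e k" using \<N>(3) en by blast
    obtain i where i: "i \<in> A" "k \<le> i" using A by (meson infinite_nat_iff_unbounded_le)
    have mono: "h a \<le> h b" if "a \<le> b" for a b using h that by (simp add: strict_mono_less_eq)
    have "x \<in> g i (h i)" if x: "x \<in> s'" "h i \<le> x" "x < h (Suc i)" for x
    proof -
      have "x \<notin> s" using i x by (auto simp: A_def)
      then obtain j where j: "x \<in> g j (h j)" using x by (auto simp: s'_def)
      then have "h j \<le> x" "x < h (Suc j)" using fg(2)[of j "h j"] by (auto simp: hSuc)
      then have "j = i" using x mono[of "Suc j" i] mono[of "Suc i" j] by linarith
      then show ?thesis using j by simp
    qed
    moreover have "g i (h i) \<subseteq> s' \<inter> {h i..<h (Suc i)}"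
      using fg(2)[of i "h i"] i(1) by (auto simp: s'_def hSuc)
    moreover have "{..<h (Suc i)} = {..<h i} \<union> {h i..<h (Suc i)}"
      using mono[of i "Suc i"] by auto
    ultimately have "s' \<inter> {..<h (Suc i)} = (s' \<inter> {..<h i}) \<union> g i (h i)"
      by auto
    then show False
      using fg(3)[of "s' \<inter> {..<h i}" "h i" k i s'] k i(2) \<open>s' \<subseteq> \<nat>\<^sub>1\<close> hSuc by auto
  qed
  then show thesis using that h by blast
qed

lemma nth_elem_mono: "\<lbrakk>infinite a; m \<le> n\<rbrakk> \<Longrightarrow> nth_elem a m \<le> nth_elem a n"
  by (simp add: nth_elem_def diff_le_mono)

lemma Inf_sets_dominating:
  obtains a where "a \<in> Inf_sets" "\<And>p. 1 \<le> p \<Longrightarrow> g p \<le> nth_elem a p"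
proof -
  define f where "f k = Suc k + (\<Sum>i\<le>Suc k. g i)" for k
  have f: "strict_mono f" by (simp add: strict_mono_Suc_iff f_def)
  let ?a = "range f"
  have inf: "infinite ?a" using f by (simp add: range_inj_infinite strict_mono_imp_inj_on)
  have "f k \<le> enumerate ?a k" for k
  proof (induction k)
    case 0
    have "enumerate ?a 0 \<in> ?a" using inf by (rule enumerate_in_set)
    then show ?case using f by (auto simp: strict_mono_less_eq)
  next
    case (Suc k)
    have "enumerate ?a (Suc k) \<in> ?a" using inf by (rule enumerate_in_set)
    then obtain l where l: "enumerate ?a (Suc k) = f l" by blast
    have "f k < f l" using Suc.IH enumerate_step[OF inf, of k] l by linarith
    then show ?case using f l by (simp add: strict_mono_less strict_mono_less_eq)
  qed
  moreover have "g p \<le> f (p - 1)" if "1 \<le> p" for p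
  proof -
    have "g p \<le> (\<Sum>i\<le>Suc (p - 1). g i)" using that by (intro member_le_sum) auto
    then show ?thesis by (simp add: f_def)
  qed
  ultimately have "g p \<le> nth_elem ?a p" if "1 \<le> p" for p
    unfolding nth_elem_def using that le_trans by blast
  moreover have "?a \<in> Inf_sets" using inf by (auto simp: Inf_sets_def f_def)
  ultimately show thesis using that by blast
qed

lemma exists_empty_gap:
  assumes b: "strict_mono b" and x: "infinite x" and p: "1 \<le> p" "p \<le> q" "b (n + q) \<le> nth_elem x p"
  shows "\<exists>j\<in>{n..<n + q}. x \<inter> {b j..<b (Suc j)} = {}"
proof (rule ccontr)
  assume "\<not> ?thesis"
  then have "\<forall>j\<in>{n..<n + q}. \<exists>z. z \<in> x \<inter> {b j..<b (Suc j)}" by blast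
  then obtain e where e: "\<And>j. j \<in> {n..<n + q} \<Longrightarrow> e j \<in> x \<inter> {b j..<b (Suc j)}"
    by metis
  have bm: "b i \<le> b j" if "i \<le> j" for i j using b that by (simp add: strict_mono_less_eq)
  have "inj_on e {n..<n + q}"
  proof (rule inj_onI)
    fix i j assume ij: "i \<in> {n..<n + q}" "j \<in> {n..<n + q}" "e i = e j"
    then have "b i < b (Suc j)" "b j < b (Suc i)" using e[of i] e[of j] by auto
    then show "i = j" using b by (simp add: strict_mono_less)
  qed
  moreover have "e ` {n..<n + q} \<subseteq> enumerate x ` {..<p - 1}"
  proof
    fix z assume "z \<in> e ` {n..<n + q}"
    then obtain j where j: "j \<in> {n..<n + q}" "z = e j" by blast
    then obtain k where k: "enumerate x k = z" using e[OF j(1)] enumerate_Ex[OF x] by blast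
    have "z < b (Suc j)" using e[OF j(1)] j(2) by auto
    also have "\<dots> \<le> b (n + q)" using j(1) by (intro bm) auto
    also have "\<dots> \<le> enumerate x (p - 1)" using p(3) by (simp add: nth_elem_def)
    finally have "k < p - 1" using k x by auto
    then show "z \<in> enumerate x ` {..<p - 1}" using k by blast
  qed
  ultimately have "card {n..<n + q} \<le> card (enumerate x ` {..<p - 1})"
    by (intro card_inj_on_le) auto
  also have "\<dots> \<le> p - 1" using card_image_le[of "{..<p - 1}" "enumerate x"] by simp
  finally show False using p by simp
qed

lemma less_bnum_bounded:
  fixes f :: "nat set \<Rightarrow> nat \<Rightarrow> nat"
  assumes S: "semifilter S" and h: "strict_mono h"
    and hS: "\<And>s. s \<in> S \<Longrightarrow> finite {i. s \<inter> {h i..<h (Suc i)} = {}}"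
    and B: "|B| <o bnum S"
  shows "\<exists>g. \<forall>x\<in>B. finite {n. \<not> f x n \<le> g n}"
proof -
  have "\<exists>a. a \<in> Inf_sets \<and> (\<forall>p\<ge>1. f x p \<le> nth_elem a p)" for x
    by (rule Inf_sets_dominating[of "f x"]) blast
  then obtain a where a: "\<And>x. a x \<in> Inf_sets" "\<And>x p. 1 \<le> p \<Longrightarrow> f x p \<le> nth_elem (a x) p"
    by metis
  have "|a ` B| <o bnum S" using card_of_image B by (rule ordLeq_ordLess_trans)
  then have "\<not> unbounded_rel S (a ` B)" using bnum[OF S] not_ordLess_ordLeq by blast
  then obtain c where c: "c \<in> Inf_sets" "\<And>x. x \<in> B \<Longrightarrow> le_rel S (a x) c"
    using a(1) unfolding unbounded_rel_def by blast
  have inf: "infinite c" "infinite (a x)" for x using c(1) a(1)[of x] by (auto simp: Inf_sets_def)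
  have "finite {n. \<not> f x n \<le> nth_elem c (h (Suc n))}" if x: "x \<in> B" for x
  proof (rule finite_subset)
    let ?s = "le_set (a x) c"
    show "finite (insert 0 {n. ?s \<inter> {h n..<h (Suc n)} = {}})"
      using hS[of ?s] c(2)[OF x] by (simp add: le_rel_def)
    show "{n. \<not> f x n \<le> nth_elem c (h (Suc n))} \<subseteq> insert 0 {n. ?s \<inter> {h n..<h (Suc n)} = {}}"
    proof (rule subsetI, rule ccontr)
      fix n assume n: "n \<in> {n. \<not> f x n \<le> nth_elem c (h (Suc n))}"
        "n \<notin> insert 0 {n. ?s \<inter> {h n..<h (Suc n)} = {}}"
      then obtain p where p: "p \<in> ?s" "h n \<le> p" "p < h (Suc n)" by auto
      have "f x n \<le> nth_elem (a x) n" using n(2) by (intro a(2)) auto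
      also have "\<dots> \<le> nth_elem (a x) p"
        using p(2) strict_mono_imp_increasing[OF h, of n] by (intro nth_elem_mono inf) linarith
      also have "\<dots> \<le> nth_elem c p" using p(1) by (simp add: le_set_def)
      also have "\<dots> \<le> nth_elem c (h (Suc n))" using p(3) by (intro nth_elem_mono inf) simp
      finally show False using n(1) by simp
    qed
  qed
  then show ?thesis
    by (intro exI[of _ "\<lambda>n. nth_elem c (h (Suc n))"] ballI)
qed

lemma Hurewicz_spaceI:
  assumes "\<And>\<U> :: nat \<Rightarrow> 'a set set. (\<And>n. open_cover X (\<U> n)) \<Longrightarrow>
    \<exists>\<F>. (\<forall>n. finite (\<F> n) \<and> \<F> n \<subseteq> \<U> n) \<and> (\<forall>x\<in>topspace X. finite {n. x \<notin> \<Union>(\<F> n)})"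
  shows "Hurewicz_space X"
  unfolding Hurewicz_space_def
proof (intro allI impI)
  fix \<U> :: "nat \<Rightarrow> 'a set set" assume "\<forall>n\<in>\<nat>\<^sub>1. open_cover X (\<U> n)"
  then have "open_cover X (\<U> (Suc n))" for n by simp
  from assms[of "\<lambda>n. \<U> (Suc n)", OF this] obtain \<F> where "\<forall>n. finite (\<F> n) \<and> \<F> n \<subseteq> \<U> (Suc n)"
    "\<forall>x\<in>topspace X. finite {n. x \<notin> \<Union>(\<F> n)}"
    by (elim exE conjE)
  then have \<F>: "\<And>n. finite (\<F> n)" "\<And>n. \<F> n \<subseteq> \<U> (Suc n)"
    "\<And>x. x \<in> topspace X \<Longrightarrow> finite {n. x \<notin> \<Union>(\<F> n)}"
    by simp_all
  show "\<exists>\<F>. (\<forall>n\<in>\<nat>\<^sub>1. finite (\<F> n) \<and> \<F> n \<subseteq> \<U> n) \<and>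
      (\<forall>x\<in>topspace X. finite (\<nat>\<^sub>1 - {n \<in> \<nat>\<^sub>1. x \<in> \<Union>(\<F> n)}))"
  proof (intro exI[of _ "\<lambda>n. \<F> (n - 1)"] conjI ballI)
    fix n :: nat assume "n \<in> \<nat>\<^sub>1"
    then show "finite (\<F> (n - 1))" "\<F> (n - 1) \<subseteq> \<U> n" using \<F>(1,2)[of "n - 1"] by auto
  next
    fix x assume "x \<in> topspace X"
    then have "finite (Suc ` {n. x \<notin> \<Union>(\<F> n)})" using \<F>(3) by blast
    moreover have "\<nat>\<^sub>1 - {n \<in> \<nat>\<^sub>1. x \<in> \<Union>(\<F> (n - 1))} \<subseteq> Suc ` {n. x \<notin> \<Union>(\<F> n)}"
    proof
      fix n assume "n \<in> \<nat>\<^sub>1 - {n \<in> \<nat>\<^sub>1. x \<in> \<Union>(\<F> (n - 1))}"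
      then show "n \<in> Suc ` {n. x \<notin> \<Union>(\<F> n)}" by (intro image_eqI[of _ _ "n - 1"]) auto
    qed
    ultimately show "finite (\<nat>\<^sub>1 - {n \<in> \<nat>\<^sub>1. x \<in> \<Union>(\<F> (n - 1))})" by (rule finite_subset[rotated])
  qed
qed

lemma openin_prod_topology_slice:
  assumes "openin (prod_topology T Y) U"
  shows "openin Y {y. (x, y) \<in> U}"
proof (subst openin_subopen, intro ballI)
  fix y assume "y \<in> {y. (x, y) \<in> U}"
  then have "(x, y) \<in> U" by simp
  with assms obtain G V where "openin Y V" "x \<in> G" "y \<in> V" "G \<times> V \<subseteq> U"
    unfolding openin_prod_topology_alt by meson
  then show "\<exists>V. openin Y V \<and> y \<in> V \<and> V \<subseteq> {y. (x, y) \<in> U}" by blast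
qed

lemma Hurewicz_selection_bounded_union:
  assumes L: "Lindelof_space (prod_topology T Y)" and Y: "Hurewicz_space Y"
    and B: "B \<subseteq> topspace T"
    and bounded: "\<And>f. \<exists>g :: nat \<Rightarrow> nat. \<forall>x\<in>B. finite {n. \<not> f x n \<le> g n}"
    and \<U>: "\<And>n::nat. open_cover (prod_topology T Y) (\<U> n)"
  shows "\<exists>\<H>. (\<forall>n. finite (\<H> n) \<and> \<H> n \<subseteq> \<U> n) \<and>
    (\<forall>x\<in>B. \<forall>y\<in>topspace Y. finite {n. (x, y) \<notin> \<Union>(\<H> n)})"
proof (cases "topspace (prod_topology T Y) = {}")
  case True
  then have "B = {} \<or> topspace Y = {}" using B by auto
  then show ?thesis by (intro exI[of _ "\<lambda>_. {}"]) auto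
next
  case False
  have "\<exists>e::nat \<Rightarrow> _. range e \<subseteq> \<U> n \<and> \<Union>(range e) = topspace (prod_topology T Y)" for n
  proof -
    from L[unfolded Lindelof_space_def, rule_format, OF \<U>[of n, unfolded open_cover_def]]
    obtain \<V> where \<V>: "countable \<V>" "\<V> \<subseteq> \<U> n" "\<Union>\<V> = topspace (prod_topology T Y)"
      by (elim exE conjE)
    then have "\<V> \<noteq> {}" using False by (metis Union_empty)
    then have "range (from_nat_into \<V>) = \<V>" using \<V>(1) by (rule range_from_nat_into)
    with \<V> show ?thesis by (intro exI[of _ "from_nat_into \<V>"]) simp
  qed
  then have "\<forall>n. \<exists>e::nat \<Rightarrow> _. range e \<subseteq> \<U> n \<and> \<Union>(range e) = topspace (prod_topology T Y)" ..
  then obtain e :: "nat \<Rightarrow> nat \<Rightarrow> _"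
    where "\<forall>n. range (e n) \<subseteq> \<U> n \<and> \<Union>(range (e n)) = topspace (prod_topology T Y)"
    by (rule choice[THEN exE])
  then have e: "\<And>n. range (e n) \<subseteq> \<U> n"
    "\<And>n. \<Union>(range (e n)) = topspace (prod_topology T Y)" by simp_all
  have "\<exists>f. \<forall>y\<in>topspace Y. finite {n. (x, y) \<notin> \<Union>(e n ` {..f n})}" if x: "x \<in> B" for x
  proof -
    define w where "w n k = {y. (x, y) \<in> e n k}" for n k
    have cover: "open_cover Y (range (w n))" for n
      unfolding open_cover_def
    proof
      have "openin (prod_topology T Y) (e n k)" for k
        using e(1)[of n] \<U>[of n] unfolding open_cover_def by blast
      from openin_prod_topology_slice[OF this]
      show o: "\<forall>V\<in>range (w n). openin Y V" by (simp add: w_def)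
      show "\<Union>(range (w n)) = topspace Y"
      proof
        show "\<Union>(range (w n)) \<subseteq> topspace Y" using o openin_subset by blast
        have "(x, y) \<in> \<Union>(range (e n))" if "y \<in> topspace Y" for y
          using that x B e(2) by auto
        then show "topspace Y \<subseteq> \<Union>(range (w n))" by (auto simp: w_def)
      qed
    qed
    from Hurewicz_space_countable_index[of Y "\<lambda>n. range (w n)", OF Y cover]
    obtain \<F> where "\<forall>n. finite (\<F> n) \<and> \<F> n \<subseteq> range (w n)"
      "\<forall>y\<in>topspace Y. finite {n. y \<notin> \<Union>(\<F> n)}"
      by (elim exE conjE)
    then have \<F>: "\<And>n. finite (\<F> n)" "\<And>n. \<F> n \<subseteq> range (w n)"
      "\<And>y. y \<in> topspace Y \<Longrightarrow> finite {n. y \<notin> \<Union>(\<F> n)}"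
      by simp_all
    have "\<exists>k. \<F> n \<subseteq> w n ` {..k}" for n
    proof -
      obtain C where C: "finite C" "\<F> n = w n ` C"
        using finite_subset_image[OF \<F>(1,2)] by blast
      from C(1) obtain k where "\<forall>i\<in>C. i \<le> k" unfolding finite_nat_set_iff_bounded_le ..
      with C(2) show ?thesis by (intro exI[of _ k]) auto
    qed
    then obtain f where f: "\<And>n. \<F> n \<subseteq> w n ` {..f n}" by metis
    have "finite {n. (x, y) \<notin> \<Union>(e n ` {..f n})}" if "y \<in> topspace Y" for y
    proof (rule finite_subset[OF _ \<F>(3)[OF that]])
      have "(x, y) \<in> \<Union>(e n ` {..f n})" if "y \<in> \<Union>(\<F> n)" for n
        using that f[of n] by (auto simp: w_def)
      then show "{n. (x, y) \<notin> \<Union>(e n ` {..f n})} \<subseteq> {n. y \<notin> \<Union>(\<F> n)}" by blast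
    qed
    then show ?thesis by (intro exI[of _ f] ballI)
  qed
  then have "\<forall>x\<in>B. \<exists>f. \<forall>y\<in>topspace Y. finite {n. (x, y) \<notin> \<Union>(e n ` {..f n})}" ..
  then obtain f where "\<forall>x\<in>B. \<forall>y\<in>topspace Y. finite {n. (x, y) \<notin> \<Union>(e n ` {..f x n})}"
    by (rule bchoice[THEN exE])
  then have f: "finite {n. (x, y) \<notin> \<Union>(e n ` {..f x n})}" if "x \<in> B" "y \<in> topspace Y" for x y
    using that by blast
  from bounded[of f] obtain g where g: "\<forall>x\<in>B. finite {n. \<not> f x n \<le> g n}" ..
  have "finite {n. (x, y) \<notin> \<Union>(e n ` {..g n})}" if "x \<in> B" "y \<in> topspace Y" for x y
  proof (rule finite_subset)
    show "finite ({n. \<not> f x n \<le> g n} \<union> {n. (x, y) \<notin> \<Union>(e n ` {..f x n})})"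
      using f[OF that] g that(1) by simp
    show "{n. (x, y) \<notin> \<Union>(e n ` {..g n})} \<subseteq> {n. \<not> f x n \<le> g n} \<union> {n. (x, y) \<notin> \<Union>(e n ` {..f x n})}"
      by (auto intro: le_trans)
  qed
  then show ?thesis
    using e(1) by (intro exI[of _ "\<lambda>n. e n ` {..g n}"]) (auto simp: image_subset_iff)
qed

lemma openin_prod_Cantor_box:
  assumes A: "A \<subseteq> Pow \<nat>\<^sub>1" and U: "openin (prod_topology (subtopology Cantor A) Y) U" "(x, y) \<in> U"
  shows "\<exists>m V. openin Y V \<and> y \<in> V \<and> (\<forall>z\<in>A. z \<inter> {..<m} = x \<inter> {..<m} \<longrightarrow> {z} \<times> V \<subseteq> U)"
proof -
  from U obtain G V where G: "openin (subtopology Cantor A) G" "openin Y V" "x \<in> G" "y \<in> V" "G \<times> V \<subseteq> U"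
    unfolding openin_prod_topology_alt by meson
  from G(1) obtain W where W: "openin Cantor W" "G = W \<inter> A" unfolding openin_subtopology by blast
  then have "x \<in> W" using G(3) by blast
  with W(1) obtain m where m: "\<And>z. \<lbrakk>z \<subseteq> \<nat>\<^sub>1; z \<inter> {..<m} = x \<inter> {..<m}\<rbrakk> \<Longrightarrow> z \<in> W"
    using openin_Cantor_contains_cylinder by metis
  have "{z} \<times> V \<subseteq> U" if "z \<in> A" "z \<inter> {..<m} = x \<inter> {..<m}" for z
  proof -
    have "z \<in> W" using that A by (intro m) auto
    then have "z \<in> G" using W(2) that(1) by simp
    then show ?thesis using G(5) by auto
  qed
  then show ?thesis using G(2,4) by (intro exI[of _ m] exI[of _ V]) simp
qed

text \<open>A point of \<open>A\<close> that misses \<open>{a..<m}\<close> agrees up to \<open>m\<close> with one of the finitely many subsets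
  of \<open>{..<a}\<close>; so for large \<open>m\<close> all such points can be covered at once, simultaneously for the
  covers \<open>\<U> 0, \<dots>, \<U> j\<close>.\<close>

definition gap_cover ::
    "nat set set \<Rightarrow> (nat \<Rightarrow> (nat set \<times> 'a) set set) \<Rightarrow> nat \<Rightarrow> nat \<Rightarrow> nat \<Rightarrow>
     (nat \<Rightarrow> (nat set \<times> 'a) set set) \<Rightarrow> 'a set \<Rightarrow> bool" where
  "gap_cover A \<U> j a m \<F> V \<longleftrightarrow> (\<forall>n\<le>j. finite (\<F> n) \<and> \<F> n \<subseteq> \<U> n \<and>
     (\<forall>z\<in>A. z \<inter> {a..<m} = {} \<longrightarrow> {z} \<times> V \<subseteq> \<Union>(\<F> n)))"

lemma exists_gap_cover:
  assumes A: "Fin_sets \<subseteq> A" "A \<subseteq> Pow \<nat>\<^sub>1"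
    and \<U>: "\<And>n::nat. open_cover (prod_topology (subtopology Cantor A) Y) (\<U> n)"
    and y: "y \<in> topspace Y"
  shows "\<exists>V. openin Y V \<and> y \<in> V \<and> (\<exists>m \<F>. gap_cover A \<U> j a m \<F> V)"
proof -
  define P where "P = Pow (\<nat>\<^sub>1 \<inter> {..<a}) \<times> {..j}"
  have P: "finite P" "P \<noteq> {}" by (auto simp: P_def)
  have "\<forall>p\<in>P. \<exists>q. fst (snd q) \<in> \<U> (snd p) \<and> openin Y (snd (snd q)) \<and> y \<in> snd (snd q) \<and>
      (\<forall>z\<in>A. z \<inter> {..<fst q} = fst p \<inter> {..<fst q} \<longrightarrow> {z} \<times> snd (snd q) \<subseteq> fst (snd q))"
  proof
    fix p assume p: "p \<in> P"
    then have "fst p \<in> Fin_sets" by (auto simp: P_def Fin_sets_def intro: finite_subset[of _ "{..<a}"])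
    then have "fst p \<in> topspace (subtopology Cantor A)" using A by (auto simp: topspace_Cantor)
    then have "(fst p, y) \<in> topspace (prod_topology (subtopology Cantor A) Y)" using y by simp
    then obtain U where U: "U \<in> \<U> (snd p)" "(fst p, y) \<in> U"
      using \<U>[of "snd p"] unfolding open_cover_def by blast
    then have "openin (prod_topology (subtopology Cantor A) Y) U"
      using \<U>[of "snd p"] unfolding open_cover_def by blast
    from openin_prod_Cantor_box[OF A(2) this U(2)] obtain m V where
      "openin Y V" "y \<in> V" "\<forall>z\<in>A. z \<inter> {..<m} = fst p \<inter> {..<m} \<longrightarrow> {z} \<times> V \<subseteq> U"
      by (elim exE conjE)
    with U(1) show "\<exists>q. fst (snd q) \<in> \<U> (snd p) \<and> openin Y (snd (snd q)) \<and> y \<in> snd (snd q) \<and>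
      (\<forall>z\<in>A. z \<inter> {..<fst q} = fst p \<inter> {..<fst q} \<longrightarrow> {z} \<times> snd (snd q) \<subseteq> fst (snd q))"
      by (intro exI[of _ "(m, U, V)"]) simp
  qed
  then obtain q where q: "\<forall>p\<in>P. fst (snd (q p)) \<in> \<U> (snd p) \<and> openin Y (snd (snd (q p))) \<and>
      y \<in> snd (snd (q p)) \<and> (\<forall>z\<in>A. z \<inter> {..<fst (q p)} = fst p \<inter> {..<fst (q p)} \<longrightarrow>
        {z} \<times> snd (snd (q p)) \<subseteq> fst (snd (q p)))"
    by (rule bchoice[THEN exE])
  define m where "m p = fst (q p)" for p
  define U where "U p = fst (snd (q p))" for p
  define V where "V p = snd (snd (q p))" for p
  have q1: "U p \<in> \<U> (snd p)" "openin Y (V p)" "y \<in> V p" if "p \<in> P" for p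
    using q that by (simp_all add: U_def V_def)
  have q2: "{z} \<times> V p \<subseteq> U p" if "p \<in> P" "z \<in> A" "z \<inter> {..<m p} = fst p \<inter> {..<m p}" for p z
    using q that unfolding m_def U_def V_def by blast
  define M where "M = a + (\<Sum>p\<in>P. m p)"
  define \<F> where "\<F> n = U ` (Pow (\<nat>\<^sub>1 \<inter> {..<a}) \<times> {n})" for n
  have "gap_cover A \<U> j a M \<F> (\<Inter>(V ` P))"
    unfolding gap_cover_def
  proof (intro allI impI conjI ballI)
    fix n assume n: "n \<le> j"
    show "finite (\<F> n)" by (simp add: \<F>_def)
    show "\<F> n \<subseteq> \<U> n"
    proof
      fix W assume "W \<in> \<F> n"
      then obtain s where s: "s \<in> Pow (\<nat>\<^sub>1 \<inter> {..<a})" "W = U (s, n)" by (auto simp: \<F>_def)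
      then have "(s, n) \<in> P" using n by (simp add: P_def)
      from q1(1)[OF this] show "W \<in> \<U> n" by (simp add: s)
    qed
    fix z assume z: "z \<in> A" "z \<inter> {a..<M} = {}"
    define s where "s = z \<inter> {..<a}"
    have "s \<in> Pow (\<nat>\<^sub>1 \<inter> {..<a})" using z(1) A(2) by (auto simp: s_def)
    then have p: "(s, n) \<in> P" "U (s, n) \<in> \<F> n" using n by (auto simp: P_def \<F>_def)
    have "m (s, n) \<le> (\<Sum>p\<in>P. m p)" using p(1) P(1) by (intro member_le_sum) auto
    then have "m (s, n) \<le> M" by (simp add: M_def)
    then have "z \<inter> {..<m (s, n)} = s \<inter> {..<m (s, n)}"
      using z(2) unfolding s_def by fastforce
    then have "{z} \<times> V (s, n) \<subseteq> U (s, n)" using q2[OF p(1) z(1)] by simp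
    moreover have "\<Inter>(V ` P) \<subseteq> V (s, n)" using p(1) by blast
    ultimately show "{z} \<times> \<Inter>(V ` P) \<subseteq> \<Union>(\<F> n)" using p(2) by blast
  qed
  moreover have "openin Y (\<Inter>(V ` P))" using P q1(2) by (intro openin_Inter) auto
  moreover have "y \<in> \<Inter>(V ` P)" using q1(3) by blast
  ultimately show ?thesis by (intro exI[of _ "\<Inter>(V ` P)"] conjI exI)
qed

lemma Hurewicz_gap_selection:
  assumes A: "Fin_sets \<subseteq> A" "A \<subseteq> Pow \<nat>\<^sub>1" and Y: "Hurewicz_space Y"
    and \<U>: "\<And>n::nat. open_cover (prod_topology (subtopology Cantor A) Y) (\<U> n)"
  shows "\<exists>M \<F>. (\<forall>j a. a < M j a) \<and> (\<forall>j a. \<forall>n\<le>j. finite (\<F> j a n) \<and> \<F> j a n \<subseteq> \<U> n) \<and>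
    (\<forall>y\<in>topspace Y. finite {(j, a). \<exists>n\<le>j. \<exists>z\<in>A. z \<inter> {a..<M j a} = {} \<and> (z, y) \<notin> \<Union>(\<F> j a n)})"
proof -
  define \<W> where "\<W> p = {V. openin Y V \<and> (\<exists>m \<F>. gap_cover A \<U> (fst p) (snd p) m \<F> V)}" for p
  have cover: "open_cover Y (\<W> p)" for p
    unfolding open_cover_def
  proof
    show "\<forall>V\<in>\<W> p. openin Y V" by (simp add: \<W>_def)
    show "\<Union>(\<W> p) = topspace Y"
    proof
      show "\<Union>(\<W> p) \<subseteq> topspace Y" by (auto simp: \<W>_def dest: openin_subset)
      show "topspace Y \<subseteq> \<Union>(\<W> p)"
      proof
        fix y assume "y \<in> topspace Y"
        from exists_gap_cover[of A Y \<U> y "fst p" "snd p", OF A \<U> this]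
        obtain V where "openin Y V \<and> y \<in> V \<and> (\<exists>m \<F>. gap_cover A \<U> (fst p) (snd p) m \<F> V)" ..
        then show "y \<in> \<Union>(\<W> p)" by (intro UnionI[of V]) (simp_all add: \<W>_def)
      qed
    qed
  qed
  from Hurewicz_space_countable_index[of Y \<W>, OF Y cover]
  obtain \<G> where "\<forall>p. finite (\<G> p) \<and> \<G> p \<subseteq> \<W> p"
    "\<forall>y\<in>topspace Y. finite {p. y \<notin> \<Union>(\<G> p)}"
    by (elim exE conjE)
  then have \<G>: "\<And>p. finite (\<G> p)" "\<And>p. \<G> p \<subseteq> \<W> p"
    "\<And>y. y \<in> topspace Y \<Longrightarrow> finite {p. y \<notin> \<Union>(\<G> p)}"
    by (simp_all del: split_paired_All)
  define q where "q p V = (SOME q. gap_cover A \<U> (fst p) (snd p) (fst q) (snd q) V)" for p V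
  define m where "m p V = fst (q p V)" for p V
  define \<E> where "\<E> p V = snd (q p V)" for p V
  have mE: "gap_cover A \<U> (fst p) (snd p) (m p V) (\<E> p V) V" if "V \<in> \<G> p" for p V
  proof -
    have "\<exists>m \<F>. gap_cover A \<U> (fst p) (snd p) m \<F> V"
      using that \<G>(2)[of p] unfolding \<W>_def by blast
    then obtain m \<F> where "gap_cover A \<U> (fst p) (snd p) m \<F> V" by (elim exE)
    then have "gap_cover A \<U> (fst p) (snd p) (fst (m, \<F>)) (snd (m, \<F>)) V" by simp
    then show ?thesis unfolding m_def \<E>_def q_def by (rule someI)
  qed
  define M where "M j a = Suc a + (\<Sum>V\<in>\<G> (j, a). m (j, a) V)" for j a
  define \<F> where "\<F> j a n = (\<Union>V\<in>\<G> (j, a). \<E> (j, a) V n)" for j a n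
  show ?thesis
  proof (intro exI[of _ M] exI[of _ \<F>] conjI allI impI ballI)
    show "a < M j a" for j a by (simp add: M_def)
    show "finite (\<F> j a n)" "\<F> j a n \<subseteq> \<U> n" if "n \<le> j" for j a n
      using mE[of _ "(j, a)"] that \<G>(1)[of "(j, a)"] by (simp_all add: \<F>_def gap_cover_def UN_subset_iff)
    fix y assume y: "y \<in> topspace Y"
    have covered: "(z, y) \<in> \<Union>(\<F> j a n)"
      if z: "y \<in> \<Union>(\<G> (j, a))" "n \<le> j" "z \<in> A" "z \<inter> {a..<M j a} = {}" for j a n z
    proof -
      obtain V where V: "V \<in> \<G> (j, a)" "y \<in> V" using z(1) by blast
      have "m (j, a) V \<le> (\<Sum>V\<in>\<G> (j, a). m (j, a) V)"
        using V(1) \<G>(1) by (intro member_le_sum) auto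
      then have "m (j, a) V \<le> M j a" by (simp add: M_def)
      then have "{a..<m (j, a) V} \<subseteq> {a..<M j a}" by auto
      then have "z \<inter> {a..<m (j, a) V} = {}" using z(4) by blast
      then have "{z} \<times> V \<subseteq> \<Union>(\<E> (j, a) V n)"
        using mE[OF V(1)] z(2,3) by (simp add: gap_cover_def)
      then have "(z, y) \<in> \<Union>(\<E> (j, a) V n)" using V(2) by blast
      then show ?thesis using V(1) unfolding \<F>_def by blast
    qed
    have "{(j, a). \<exists>n\<le>j. \<exists>z\<in>A. z \<inter> {a..<M j a} = {} \<and> (z, y) \<notin> \<Union>(\<F> j a n)}
        \<subseteq> {p. y \<notin> \<Union>(\<G> p)}"
    proof
      fix p assume "p \<in> {(j, a). \<exists>n\<le>j. \<exists>z\<in>A. z \<inter> {a..<M j a} = {} \<and> (z, y) \<notin> \<Union>(\<F> j a n)}"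
      then obtain j a n z where p: "p = (j, a)" "n \<le> j" "z \<in> A" "z \<inter> {a..<M j a} = {}"
        and nin: "(z, y) \<notin> \<Union>(\<F> j a n)"
        by (elim CollectE case_prodE bexE exE conjE)
      have "y \<notin> \<Union>(\<G> (j, a))" using covered[OF _ p(2-4)] nin by (rule contrapos_nn[rotated])
      then show "p \<in> {p. y \<notin> \<Union>(\<G> p)}" by (simp only: p(1) mem_Collect_eq not_False_eq_True)
    qed
    then show "finite {(j, a). \<exists>n\<le>j. \<exists>z\<in>A. z \<inter> {a..<M j a} = {} \<and> (z, y) \<notin> \<Union>(\<F> j a n)}"
      using \<G>(3)[OF y] by (rule finite_subset)
  qed
qed

theorem theorem5p4:
  fixes S X :: "nat set set" and Y :: "'a topology"
  assumes "semifilter S"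
    and "meager_in Cantor S"
    and "semifilter_scale S X"
    and "hereditarily Lindelof_space Y"
    and "Hurewicz_space Y"
  shows "Hurewicz_space (prod_topology (subtopology Cantor (X \<union> Fin_sets)) Y)"
proof (rule Hurewicz_spaceI)
  define A where "A = X \<union> Fin_sets"
  have X: "X \<subseteq> Inf_sets" "bnum S \<le>o |X|" using assms(3) by (auto simp: semifilter_scale_def)
  have A: "Fin_sets \<subseteq> A" "A \<subseteq> Pow \<nat>\<^sub>1"
    using X(1) by (auto simp: A_def Inf_sets_def Fin_sets_def)
  have top: "topspace (subtopology Cantor A) = A" using A(2) by (auto simp: topspace_Cantor)
  fix \<U> :: "nat \<Rightarrow> (nat set \<times> 'a) set set"
  assume "\<And>n. open_cover (prod_topology (subtopology Cantor (X \<union> Fin_sets)) Y) (\<U> n)"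
  then have \<U>: "open_cover (prod_topology (subtopology Cantor A) Y) (\<U> n)" for n by (simp add: A_def)
  obtain h where h: "strict_mono h" "\<And>s. s \<in> S \<Longrightarrow> finite {i. s \<inter> {h i..<h (Suc i)} = {}}"
    by (rule meager_semifilter_meets_intervals[OF assms(1,2)]) blast
  from Hurewicz_gap_selection[of A Y \<U>, OF A assms(5) \<U>]
  obtain M \<F> where "\<forall>j a. a < M j a" "\<forall>j a. \<forall>n\<le>j. finite (\<F> j a n) \<and> \<F> j a n \<subseteq> \<U> n"
    "\<forall>y\<in>topspace Y. finite {(j, a). \<exists>n\<le>j. \<exists>z\<in>A. z \<inter> {a..<M j a} = {} \<and> (z, y) \<notin> \<Union>(\<F> j a n)}"
    by (elim exE conjE)
  then have M: "\<And>j a. a < M j a"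
    and \<F>: "\<And>j a n. n \<le> j \<Longrightarrow> finite (\<F> j a n) \<and> \<F> j a n \<subseteq> \<U> n"
      "\<And>y. y \<in> topspace Y \<Longrightarrow> finite {(j, a). \<exists>n\<le>j. \<exists>z\<in>A. z \<inter> {a..<M j a} = {} \<and> (z, y) \<notin> \<Union>(\<F> j a n)}"
    by simp_all
  define b where "b = rec_nat 0 M"
  have bSuc: "b (Suc j) = M j (b j)" for j by (simp add: b_def)
  have b: "strict_mono b" by (simp add: strict_mono_Suc_iff bSuc M)
  obtain b' where b': "b' \<in> Inf_sets" "\<And>p. 1 \<le> p \<Longrightarrow> b (Suc p + h (Suc (Suc p))) \<le> nth_elem b' p"
    by (rule Inf_sets_dominating[of "\<lambda>p. b (Suc p + h (Suc (Suc p)))"]) blast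
  obtain c where c: "c \<in> Inf_sets"
    "|{x \<in> X. \<not> (le_rel (splus S) b' c \<and> le_rel S c x)}| <o bnum S"
    using assms(3) b'(1) unfolding semifilter_scale_def by blast
  define B where "B = {x \<in> X. \<not> (le_rel (splus S) b' c \<and> le_rel S c x)}"
  have "B \<noteq> X" using c(2) X(2) not_ordLess_ordLeq unfolding B_def by metis
  then have "infinite (le_set b' c)" by (auto simp: B_def le_rel_def splus_def Inf_sets_def)
  have cinf: "infinite c" using c(1) by (simp add: Inf_sets_def)
  have "\<exists>i. n \<le> i \<and> b (i + h (Suc i)) \<le> nth_elem c (h i)" for n
  proof -
    obtain p where p: "p \<in> le_set b' c" "n \<le> p"
      using \<open>infinite (le_set b' c)\<close> unfolding infinite_nat_iff_unbounded_le by blast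
    have "b (Suc p + h (Suc (Suc p))) \<le> nth_elem b' p" using p(1) by (intro b'(2)) (simp add: le_set_def)
    also have "\<dots> \<le> nth_elem c p" using p(1) by (simp add: le_set_def)
    also have "\<dots> \<le> nth_elem c (h (Suc p))"
      using strict_mono_imp_increasing[OF h(1), of "Suc p"] by (intro nth_elem_mono cinf) simp
    finally show ?thesis using p(2) by (intro exI[of _ "Suc p"]) simp
  qed
  then obtain i where i: "\<And>n. n \<le> i n" "\<And>n. b (i n + h (Suc (i n))) \<le> nth_elem c (h (i n))"
    by metis
  have "Lindelof_space (prod_topology (subtopology Cantor A) Y)"
    using second_countable_subtopology[OF second_countable_Cantor] assms(4)
    by (rule Lindelof_space_prod_second_countable)
  moreover have "B \<subseteq> topspace (subtopology Cantor A)" unfolding top by (auto simp: A_def B_def)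
  moreover have "\<exists>g. \<forall>x\<in>B. finite {n. \<not> f x n \<le> g n}" for f :: "nat set \<Rightarrow> nat \<Rightarrow> nat"
    using assms(1) h c(2)[folded B_def] by (rule less_bnum_bounded)
  ultimately have "\<exists>\<H>. (\<forall>n. finite (\<H> n) \<and> \<H> n \<subseteq> \<U> n) \<and>
      (\<forall>x\<in>B. \<forall>y\<in>topspace Y. finite {n. (x, y) \<notin> \<Union>(\<H> n)})"
    using assms(5) \<U> by (intro Hurewicz_selection_bounded_union)
  then obtain \<H> where \<H>: "\<forall>n. finite (\<H> n) \<and> \<H> n \<subseteq> \<U> n"
    "\<forall>x\<in>B. \<forall>y\<in>topspace Y. finite {n. (x, y) \<notin> \<Union>(\<H> n)}"
    by (elim exE conjE)
  define J where "J n = {n..<n + h (Suc (i n))}" for n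
  define \<K> where "\<K> n = \<H> n \<union> (\<Union>j\<in>J n. \<F> j (b j) n)" for n
  have gap: "finite {n. (x, y) \<notin> \<Union>(\<K> n)}"
    if xy: "x \<in> A" "y \<in> topspace Y" and N: "\<And>n. N \<le> n \<Longrightarrow> \<exists>j\<in>J n. x \<inter> {b j..<b (Suc j)} = {}"
    for x y N
  proof (rule finite_subset)
    define E where "E = {(j, a). \<exists>n\<le>j. \<exists>z\<in>A. z \<inter> {a..<M j a} = {} \<and> (z, y) \<notin> \<Union>(\<F> j a n)}"
    show "finite ({..<N} \<union> (\<Union>p\<in>E. {..fst p}))" using \<F>(2)[OF xy(2)] by (simp add: E_def)
    show "{n. (x, y) \<notin> \<Union>(\<K> n)} \<subseteq> {..<N} \<union> (\<Union>p\<in>E. {..fst p})"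
    proof
      fix n assume n: "n \<in> {n. (x, y) \<notin> \<Union>(\<K> n)}"
      show "n \<in> {..<N} \<union> (\<Union>p\<in>E. {..fst p})"
      proof (cases "n < N")
        case False
        then obtain j where j: "j \<in> J n" "x \<inter> {b j..<b (Suc j)} = {}" using N[of n] by auto
        have "(x, y) \<notin> \<Union>(\<F> j (b j) n)" using n j(1) by (auto simp: \<K>_def)
        then have "(j, b j) \<in> E" using j xy(1) by (auto simp: E_def J_def bSuc)
        then show ?thesis using j(1) by (auto simp: J_def intro!: bexI[of _ "(j, b j)"])
      qed simp
    qed
  qed
  have "finite {n. (x, y) \<notin> \<Union>(\<K> n)}" if xy: "x \<in> A" "y \<in> topspace Y" for x y
  proof -
    consider "x \<in> B" | "x \<in> X" "x \<notin> B" | "x \<in> Fin_sets" using xy(1) by (auto simp: A_def)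
    then show ?thesis
    proof cases
      case 1
      then have "finite {n. (x, y) \<notin> \<Union>(\<H> n)}" using \<H>(2) xy(2) by simp
      then show ?thesis by (rule rev_finite_subset) (auto simp: \<K>_def)
    next
      case 2
      let ?s = "le_set c x"
      have "?s \<in> S" using 2 by (simp add: B_def le_rel_def)
      then obtain N where N: "\<forall>k\<in>{k. ?s \<inter> {h k..<h (Suc k)} = {}}. k < N"
        using h(2) unfolding finite_nat_set_iff_bounded by blast
      show ?thesis
      proof (rule gap[OF xy])
        fix n assume "N \<le> n"
        then have "\<not> i n < N" using i(1)[of n] by simp
        then have "?s \<inter> {h (i n)..<h (Suc (i n))} \<noteq> {}" using N by blast
        then obtain p where p: "p \<in> ?s" "h (i n) \<le> p" "p < h (Suc (i n))" by auto
        have "b (n + h (Suc (i n))) \<le> b (i n + h (Suc (i n)))"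
          using b i(1)[of n] by (simp add: strict_mono_less_eq)
        also have "\<dots> \<le> nth_elem c (h (i n))" by (rule i(2))
        also have "\<dots> \<le> nth_elem c p" using p(2) by (intro nth_elem_mono cinf)
        also have "\<dots> \<le> nth_elem x p" using p(1) by (simp add: le_set_def)
        finally have "b (n + h (Suc (i n))) \<le> nth_elem x p" .
        moreover have "infinite x" using 2(1) X(1) by (auto simp: Inf_sets_def)
        moreover have "1 \<le> p" using p(1) by (simp add: le_set_def)
        ultimately show "\<exists>j\<in>J n. x \<inter> {b j..<b (Suc j)} = {}"
          unfolding J_def using b p(3) by (intro exists_empty_gap) auto
      qed
    next
      case 3
      then obtain N where N: "\<forall>k\<in>x. k < N"
        unfolding Fin_sets_def finite_nat_set_iff_bounded by blast
      show ?thesis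
      proof (rule gap[OF xy])
        fix n assume "N \<le> n"
        then have "N \<le> b n" using strict_mono_imp_increasing[OF b, of n] by simp
        then have "x \<inter> {b n..<b (Suc n)} = {}" using N by fastforce
        moreover have "0 < h (Suc (i n))"
          using strict_mono_imp_increasing[OF h(1), of "Suc (i n)"] by simp
        ultimately show "\<exists>j\<in>J n. x \<inter> {b j..<b (Suc j)} = {}"
          by (intro bexI[of _ n]) (simp_all add: J_def)
      qed
    qed
  qed
  moreover have "finite (\<K> n) \<and> \<K> n \<subseteq> \<U> n" for n
  proof
    have J: "finite (\<F> j (b j) n)" "\<F> j (b j) n \<subseteq> \<U> n" if "j \<in> J n" for j
      using \<F>(1)[of n j "b j"] that by (auto simp: J_def)
    then show "finite (\<K> n)" using \<H>(1) by (simp add: \<K>_def J_def)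
    show "\<K> n \<subseteq> \<U> n" using \<H>(1) J(2) by (simp add: \<K>_def UN_subset_iff)
  qed
  ultimately show "\<exists>\<F>. (\<forall>n. finite (\<F> n) \<and> \<F> n \<subseteq> \<U> n) \<and>
      (\<forall>p\<in>topspace (prod_topology (subtopology Cantor (X \<union> Fin_sets)) Y). finite {n. p \<notin> \<Union>(\<F> n)})"
    unfolding A_def[symmetric] topspace_prod_topology top
    by (intro exI[of _ \<K>]) auto
qed

end
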